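(* Let $\Delta$ be a simplicial complex on ground set $[n]$. Then the generalized cut polytope $\mathrm{GCut}(\Delta)$, the correlation polytope $\mathrm{Corr}(\Delta)$, and the binary marginal polytope $\mathrm{Marg}(\Delta)$ are (affinely) isomorphic to each other, and their dimension equals $\#\overline{\Delta}$, the number of nonempty faces of $\Delta$.
   Context: $[n]=\{1,\dots,n\}$. A simplicial complex on ground set $[n]$ is a nonempty set $\Delta\subset 2^{[n]}$ such that $F\in\Delta$ and $F'\subset F$ imply $F'\in\Delta$. Its elements are called faces; $\mathrm{facets}(\Delta)$ is the set of inclusion-maximal faces; $\overline{\Delta}=\Delta\setminus\{\emptyset\}$ is the set of nonempty faces. Generalized cut polytope: $\mathrm{GCut}(\Delta)=\mathrm{conv}\{\mathbf d^S : S\subset[n]\}\subset\mathbb R^{\overline\Delta}$, where for $F\in\overline\Delta$, $d^S_F=1$ if $\#(F\cap S)$ is odd and $d^S_F=0$ if $\#(F\cap S)$ is even. Correlation polytope: $\mathrm{Corr}(\Delta)=\mathrm{conv}\{\mathbf v^S : S\subset[n]\}\subset\mathbb R^{\overline\Delta}$, where for $F\in\overline\Delta$, $v^S_F=1$ if $F\subset S$ and $v^S_F=0$ otherwise. Binary marginal polytope: let $\mathcal E(\Delta)=\{(H,F) : H\subset F\in\mathrm{facets}(\Delta)\}$. Then $\mathrm{Marg}(\Delta)=\mathrm{conv}\{\mathbf u^S : S\subset[n]\}\subset\mathbb R^{\mathcal E(\Delta)}$, where $u^S_{(H,F)}=1$ if $S\cap F=H$ and $u^S_{(H,F)}=0$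 otherwise. *)

theory Defs
  imports "HOL-Analysis.Analysis" "HOL-Analysis.Finite_Function_Topology"
begin

section \<open>Simplicial complexes on the ground set \<open>{1..n}\<close>\<close>

definition simplicial_complex_on :: "nat \<Rightarrow> nat set set \<Rightarrow> bool"
  where "simplicial_complex_on n \<Delta> \<longleftrightarrow>
    \<Delta> \<noteq> {} \<and> \<Delta> \<subseteq> Pow {1..n} \<and> (\<forall>F\<in>\<Delta>. \<forall>F'. F' \<subseteq> F \<longrightarrow> F' \<in> \<Delta>)"

definition facets :: "nat set set \<Rightarrow> nat set set"
  where "facets \<Delta> = {F \<in> \<Delta>. \<forall>G\<in>\<Delta>. F \<subseteq> G \<longrightarrow> G = F}"

definition nonempty_faces :: "nat set set \<Rightarrow> nat set set"
  where "nonempty_faces \<Delta> = \<Delta> - {{}}"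

definition facet_pairs :: "nat set set \<Rightarrow> (nat set \<times> nat set) set"
  where "facet_pairs \<Delta> = {(H, F). H \<subseteq> F \<and> F \<in> facets \<Delta>}"

section \<open>Coordinate spaces, affine maps and dimension\<close>

text \<open>
  For a finite set \<open>I\<close> of indices, the space of real vectors indexed by \<open>I\<close> is identified with
  the subspace of all finitely supported functions \<open>'a \<Rightarrow>\<^sub>0 real\<close> that vanish outside \<open>I\<close>;
  \<open>coord_vector I f\<close> is the vector with entries \<open>f i\<close> for \<open>i \<in> I\<close>. The definition is only
  meaningful for finite \<open>I\<close>.
\<close>

definition coord_vector :: "'a set \<Rightarrow> ('a \<Rightarrow> real) \<Rightarrow> ('a \<Rightarrow>\<^sub>0 real)"
  where "coord_vector I f = Poly_Mapping.Abs_poly_mapping (\<lambda>i. if i \<in> I then f i else 0)"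

lemma lookup_coord_vector:
  assumes "finite I"
  shows "Poly_Mapping.lookup (coord_vector I f) i = (if i \<in> I then f i else 0)"
proof -
  have "finite {i. (if i \<in> I then f i else 0) \<noteq> 0}"
    by (rule finite_subset[OF _ assms]) auto
  then show ?thesis
    by (simp add: coord_vector_def)
qed

definition affine_map :: "('a::real_vector \<Rightarrow> 'b::real_vector) \<Rightarrow> bool"
  where "affine_map f \<longleftrightarrow> (\<exists>L c. linear L \<and> f = (\<lambda>x. L x + c))"

definition affinely_isomorphic :: "'a::real_vector set \<Rightarrow> 'b::real_vector set \<Rightarrow> bool"
  where "affinely_isomorphic P Q \<longleftrightarrow> (\<exists>f. affine_map f \<and> bij_betw f P Q)"

text \<open>
  The dimension of a nonempty set is the dimension of the linear space parallel to its affine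
  hull. The constant \<^const>\<open>aff_dim\<close> is restricted to \<^class>\<open>euclidean_space\<close>, which does not
  contain \<open>'a \<Rightarrow>\<^sub>0 real\<close>; the two agree on nonempty sets where both are defined. As with
  \<^const>\<open>dim\<close>, the value is only meaningful if the affine hull is finite-dimensional.
\<close>

definition affine_dimension :: "'a::real_vector set \<Rightarrow> nat"
  where "affine_dimension P = dim {x - y | x y. x \<in> affine hull P \<and> y \<in> affine hull P}"

lemma affine_dimension_eq_aff_dim:
  fixes P :: "'a::euclidean_space set"
  assumes "P \<noteq> {}"
  shows "int (affine_dimension P) = aff_dim P"
proof -
  obtain p where "p \<in> P"
    using assms by blast
  then have a: "p \<in> affine hull P"
    by (rule hull_inc)
  have sub: "subspace ((\<lambda>x. x - p) ` (affine hull P))"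
    by (rule affine_diffs_subspace_subtract[OF affine_affine_hull a])
  have "{x - y | x y. x \<in> affine hull P \<and> y \<in> affine hull P} = (\<lambda>x. x - p) ` (affine hull P)"
    (is "?D = ?T")
  proof
    show "?T \<subseteq> ?D" using a by blast
    show "?D \<subseteq> ?T"
    proof
      fix z assume "z \<in> ?D"
      then obtain x y where xy: "x \<in> affine hull P" "y \<in> affine hull P" "z = x - y" by blast
      have "(x - p) - (y - p) \<in> ?T"
        by (rule subspace_diff[OF sub imageI[OF xy(1)] imageI[OF xy(2)]])
      then show "z \<in> ?T" by (simp only: xy(3) diff_diff_eq2 diff_add_cancel)
    qed
  qed
  moreover have "aff_dim P = int (dim ?T)"
    using aff_dim_eq_dim_subtract[of p "affine hull P"] a
    by (simp only: hull_hull aff_dim_affine_hull)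
  ultimately show ?thesis
    by (simp only: affine_dimension_def)
qed

section \<open>The three polytopes\<close>

definition cut_vector :: "nat set set \<Rightarrow> nat set \<Rightarrow> (nat set \<Rightarrow>\<^sub>0 real)"
  where "cut_vector \<Delta> S =
    coord_vector (nonempty_faces \<Delta>) (\<lambda>F. if odd (card (F \<inter> S)) then 1 else 0)"

definition GCut :: "nat \<Rightarrow> nat set set \<Rightarrow> (nat set \<Rightarrow>\<^sub>0 real) set"
  where "GCut n \<Delta> = convex hull {cut_vector \<Delta> S | S. S \<subseteq> {1..n}}"

definition corr_vector :: "nat set set \<Rightarrow> nat set \<Rightarrow> (nat set \<Rightarrow>\<^sub>0 real)"
  where "corr_vector \<Delta> S =
    coord_vector (nonempty_faces \<Delta>) (\<lambda>F. if F \<subseteq> S then 1 else 0)"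

definition Corr :: "nat \<Rightarrow> nat set set \<Rightarrow> (nat set \<Rightarrow>\<^sub>0 real) set"
  where "Corr n \<Delta> = convex hull {corr_vector \<Delta> S | S. S \<subseteq> {1..n}}"

definition marg_vector :: "nat set set \<Rightarrow> nat set \<Rightarrow> (nat set \<times> nat set \<Rightarrow>\<^sub>0 real)"
  where "marg_vector \<Delta> S =
    coord_vector (facet_pairs \<Delta>) (\<lambda>(H, F). if S \<inter> F = H then 1 else 0)"

definition Marg :: "nat \<Rightarrow> nat set set \<Rightarrow> (nat set \<times> nat set \<Rightarrow>\<^sub>0 real) set"
  where "Marg n \<Delta> = convex hull {marg_vector \<Delta> S | S. S \<subseteq> {1..n}}"

end

theory Submission
  imports Defs
begin

text \<open>
  The three polytopes are convex hulls of families of points indexed by the same sets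
  \<open>S \<subseteq> {1..n}\<close>. Two such families have affinely isomorphic hulls of equal dimension as soon as
  there are affine maps in both directions that carry corresponding points to each other, and such
  maps exist as soon as every coordinate of either family is an affine function of the
  coordinates of the other. Only this has to be shown, and the correlation polytope serves as the
  hub: its coordinates are the subset indicators \<open>[F \<subseteq> S]\<close>, the products of the indicators
  \<open>[i \<in> S]\<close> over \<open>i \<in> F\<close>, so that expanding a product of sums over \<open>F\<close> into a sum over the
  subsets of \<open>F\<close> leads from one family to another.

  For the cut polytope, a coordinate is \<open>(1 - (-1)^#(F \<inter> S)) / 2\<close>, and the parity sign
  \<open>(-1)^#(F \<inter> S)\<close> is the product of \<open>1 - 2[i \<in> S]\<close> over \<open>i \<in> F\<close>. Expanding it gives the
  signs in terms of the indicators \<open>[G \<subseteq> S]\<close> with \<open>G \<subseteq> F\<close>; conversely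
  \<open>[i \<in> S] = (1 - (1 - 2[i \<in> S])) / 2\<close> gives \<open>[F \<subseteq> S]\<close> in terms of the signs of all
  \<open>G \<subseteq> F\<close>.

  For the marginal polytope, \<open>[S \<inter> F = H]\<close> is the product of \<open>[i \<in> S]\<close> over \<open>i \<in> H\<close> and of
  \<open>1 - [i \<in> S]\<close> over \<open>i \<in> F - H\<close>, which expands by inclusion-exclusion into the indicators
  \<open>[G \<subseteq> S]\<close> with \<open>H \<subseteq> G \<subseteq> F\<close>; conversely, if \<open>F\<close> is any facet containing \<open>G\<close>, then
  \<open>[G \<subseteq> S]\<close> is the sum of \<open>[S \<inter> F = H]\<close> over all \<open>H\<close> between \<open>G\<close> and \<open>F\<close>. In all these
  expansions only subsets of a face occur, which are faces again; this is where
  \<open>\<Delta>\<close> being closed under subsets enters. The empty face has a constant indicator and a constant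
  sign, hence it contributes only to the constant term.

  It remains to find the dimension of one polytope. The vertices of the correlation polytope
  include the origin, and those belonging to the nonempty faces \<open>F\<close> are unitriangular with respect
  to the unit vectors, so that the vertices affinely span the whole coordinate space.
\<close>

section \<open>Affine maps\<close>

lemma affine_map_affine_combination:
  assumes "affine_map f" "u + v = 1"
  shows "f (u *\<^sub>R x + v *\<^sub>R y) = u *\<^sub>R f x + v *\<^sub>R f y"
proof -
  obtain L c where L: "linear L" and f: "f = (\<lambda>x. L x + c)"
    using assms(1) unfolding affine_map_def by blast
  have "c = u *\<^sub>R c + v *\<^sub>R c"
    using assms(2) by (metis scaleR_add_left scaleR_one)
  then show ?thesis
    by (simp add: f linear_add[OF L] linear_scale[OF L] scaleR_add_right)
qed

lemma affine_map_diff: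
  assumes "affine_map f"
  obtains L where "linear L" "\<And>x y. f x - f y = L (x - y)"
  using assms unfolding affine_map_def by (auto simp: linear_diff)

lemma affine_map_compose:
  assumes "affine_map f" "affine_map g"
  shows "affine_map (\<lambda>x. g (f x))"
proof -
  obtain L c M d where L: "linear L" "f = (\<lambda>x. L x + c)" and M: "linear M" "g = (\<lambda>x. M x + d)"
    using assms unfolding affine_map_def by blast
  have "(\<lambda>x. g (f x)) = (\<lambda>x. (M \<circ> L) x + (M c + d))"
    by (simp add: L(2) M(2) linear_add[OF M(1)] add.assoc)
  then show ?thesis
    unfolding affine_map_def using linear_compose[OF L(1) M(1)] by blast
qed

lemma affine_map_const: "affine_map (\<lambda>x. c)"
  unfolding affine_map_def using linear_zero by (metis add_0)

lemma linear_imp_affine_map: "linear L \<Longrightarrow> affine_map L"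
  unfolding affine_map_def by (rule exI[of _ L], rule exI[of _ 0]) simp

lemma affine_map_add:
  assumes "affine_map f" "affine_map g"
  shows "affine_map (\<lambda>x. f x + g x)"
proof -
  obtain L c M d where L: "linear L" "f = (\<lambda>x. L x + c)" and M: "linear M" "g = (\<lambda>x. M x + d)"
    using assms unfolding affine_map_def by blast
  have "(\<lambda>x. f x + g x) = (\<lambda>x. (L x + M x) + (c + d))"
    by (simp add: L(2) M(2) algebra_simps)
  then show ?thesis
    unfolding affine_map_def using linear_compose_add[OF L(1) M(1)] by blast
qed

lemma affine_map_sum:
  assumes "\<And>i. i \<in> I \<Longrightarrow> affine_map (f i)"
  shows "affine_map (\<lambda>x. \<Sum>i\<in>I. f i x)"
  using assms
  by (induction I rule: infinite_finite_induct) (auto intro: affine_map_const affine_map_add)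

lemma affine_map_scaleR: "affine_map f \<Longrightarrow> affine_map (\<lambda>x. r *\<^sub>R f x)"
  using affine_map_compose[OF _ linear_imp_affine_map[OF linear_scale_self]] by blast

lemma affine_map_image_affine_hull:
  assumes "affine_map f"
  shows "f ` (affine hull A) = affine hull (f ` A)"
proof
  have "affine (f -` (affine hull (f ` A)))"
    unfolding affine_def
    using affine_affine_hull[of "f ` A", unfolded affine_def]
    by (auto simp: affine_map_affine_combination[OF assms])
  then have "affine hull A \<subseteq> f -` (affine hull (f ` A))"
    by (rule hull_minimal[rotated]) (auto intro: hull_inc)
  then show "f ` (affine hull A) \<subseteq> affine hull (f ` A)" by blast
  have "affine (f ` (affine hull A))"
    unfolding affine_def
    using affine_affine_hull[of A, unfolded affine_def]
    by (auto simp flip: affine_map_affine_combination[OF assms])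
  then show "affine hull (f ` A) \<subseteq> f ` (affine hull A)"
    by (rule hull_minimal[rotated]) (auto intro: hull_inc)
qed

lemma affine_map_image_convex_hull:
  assumes "affine_map f"
  shows "f ` (convex hull A) = convex hull (f ` A)"
proof -
  obtain L c where L: "linear L" "f = (\<lambda>x. L x + c)"
    using assms unfolding affine_map_def by blast
  have "f ` B = (\<lambda>x. c + x) ` L ` B" for B
    by (auto simp: L(2) image_image add.commute)
  then show ?thesis
    by (simp add: convex_hull_linear_image[OF L(1)] convex_hull_translation)
qed

text \<open>
  This makes two affine maps that are mutually inverse on generating points mutually inverse on
  the hulls.
\<close>

lemma affine_map_fixes_affine_hull:
  assumes "affine_map h" "\<And>x. x \<in> A \<Longrightarrow> h x = x" "x \<in> affine hull A"
  shows "h x = x"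
proof -
  have "affine {x. h x = x}"
    unfolding affine_def by (simp add: affine_map_affine_combination[OF assms(1)])
  then have "affine hull A \<subseteq> {x. h x = x}"
    by (rule hull_minimal[rotated]) (use assms(2) in blast)
  then show ?thesis
    using assms(3) by blast
qed

section \<open>Affinely equivalent families of points\<close>

text \<open>
  The maps are required to match the points index by index. This is stronger than an isomorphism
  of the hulls, but it is a condition on the points alone, and it composes.
\<close>

definition affinely_equivalent :: "'i set \<Rightarrow> ('i \<Rightarrow> 'a::real_vector) \<Rightarrow> ('i \<Rightarrow> 'b::real_vector) \<Rightarrow> bool"
  where "affinely_equivalent I a b \<longleftrightarrow>
    (\<exists>f g. affine_map f \<and> affine_map g \<and> (\<forall>i\<in>I. f (a i) = b i \<and> g (b i) = a i))"

lemma affinely_equivalent_sym: "affinely_equivalent I a b \<Longrightarrow> affinely_equivalent I b a"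
  unfolding affinely_equivalent_def by blast

lemma affinely_equivalent_trans:
  assumes "affinely_equivalent I a b" "affinely_equivalent I b c"
  shows "affinely_equivalent I a c"
proof -
  obtain f g f' g' where "affine_map f" "affine_map g" "\<forall>i\<in>I. f (a i) = b i \<and> g (b i) = a i"
    and "affine_map f'" "affine_map g'" "\<forall>i\<in>I. f' (b i) = c i \<and> g' (c i) = b i"
    using assms unfolding affinely_equivalent_def by blast
  then show ?thesis
    unfolding affinely_equivalent_def
    by (intro exI[of _ "\<lambda>x. f' (f x)"] exI[of _ "\<lambda>x. g (g' x)"]) (simp add: affine_map_compose)
qed

lemma affinely_equivalent_imp_affinely_isomorphic:
  assumes "affinely_equivalent I a b"
  shows "affinely_isomorphic (convex hull (a ` I)) (convex hull (b ` I))"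
proof -
  obtain f g where f: "affine_map f" and g: "affine_map g"
    and fg: "\<And>i. i \<in> I \<Longrightarrow> f (a i) = b i" "\<And>i. i \<in> I \<Longrightarrow> g (b i) = a i"
    using assms unfolding affinely_equivalent_def by blast
  have "f ` a ` I = b ` I"
    using fg by (force simp: image_image)
  then have "f ` (convex hull (a ` I)) = convex hull (b ` I)"
    by (simp add: affine_map_image_convex_hull[OF f])
  moreover have "g (f x) = x" if "x \<in> convex hull (a ` I)" for x
  proof (rule affine_map_fixes_affine_hull[OF affine_map_compose[OF f g]])
    show "x \<in> affine hull (a ` I)"
      using that convex_hull_subset_affine_hull by blast
  qed (use fg in auto)
  then have "inj_on f (convex hull (a ` I))"
    by (metis inj_onI)
  ultimately show ?thesis
    unfolding affinely_isomorphic_def bij_betw_def using f by blast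
qed

text \<open>
  The linear parts of the two maps are mutually inverse on the differences of points of the affine
  hulls, so they carry a basis of one direction space to a basis of the other.
\<close>

lemma affinely_equivalent_imp_affine_dimension_eq:
  assumes "affinely_equivalent I a b"
  shows "affine_dimension (convex hull (a ` I)) = affine_dimension (convex hull (b ` I))"
proof -
  obtain f g where f: "affine_map f" and g: "affine_map g"
    and fg: "\<And>i. i \<in> I \<Longrightarrow> f (a i) = b i" "\<And>i. i \<in> I \<Longrightarrow> g (b i) = a i"
    using assms unfolding affinely_equivalent_def by blast
  define D where "D = {x - y | x y. x \<in> affine hull (a ` I) \<and> y \<in> affine hull (a ` I)}"
  define D' where "D' = {x - y | x y. x \<in> affine hull (b ` I) \<and> y \<in> affine hull (b ` I)}"
  obtain L where L: "linear L" "\<And>x y. f x - f y = L (x - y)"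
    using affine_map_diff[OF f] by blast
  obtain M where M: "linear M" "\<And>x y. g x - g y = M (x - y)"
    using affine_map_diff[OF g] by blast
  have "f ` a ` I = b ` I"
    using fg by (force simp: image_image)
  then have "affine hull (b ` I) = f ` (affine hull (a ` I))"
    by (simp add: affine_map_image_affine_hull[OF f])
  then have D': "D' = L ` D"
    unfolding D_def D'_def by (force simp flip: L(2))
  have gf: "g (f x) = x" if "x \<in> affine hull (a ` I)" for x
    by (rule affine_map_fixes_affine_hull[OF affine_map_compose[OF f g] _ that]) (use fg in auto)
  have "(M \<circ> L) z = id z" if "z \<in> D" for z
    using that gf unfolding D_def by (auto simp flip: L(2) M(2))
  then have "(M \<circ> L) z = id z" if "z \<in> span D" for z
    using linear_eq_on_span[OF linear_compose[OF L(1) M(1)] linear_id] that by blast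
  then have inj: "inj_on L (span D)"
    by (metis comp_apply id_apply inj_onI)
  obtain B where B: "B \<subseteq> D" "independent B" "D \<subseteq> span B" "card B = dim D"
    using basis_exists by blast
  have span: "span B = span D"
    using B span_eq by (meson span_superset subset_trans)
  have "independent (L ` B)"
    using linear_independent_injective_image[OF L(1) B(2)] inj span by simp
  moreover have "span (L ` B) = span D'"
    by (simp add: D' linear_span_image[OF L(1)] span)
  moreover have "card (L ` B) = card B"
    using inj B(1) span_superset by (metis card_image inj_on_subset)
  ultimately have "dim D' = dim D"
    using dim_eq_card B(4) by metis
  then show ?thesis
    unfolding affine_dimension_def affine_hull_convex_hull D_def D'_def by simp
qed

section \<open>Affine dependence of coordinates\<close>

text \<open>
  A real quantity \<open>\<psi> i\<close> depends affinely on the point \<open>a i\<close>. Hiding the affine map behind an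
  existential quantifier lets the closure properties below be applied to the formula for \<open>\<psi>\<close> as it
  stands, without naming the coefficients.
\<close>

definition affine_function_of :: "'i set \<Rightarrow> ('i \<Rightarrow> 'a::real_vector) \<Rightarrow> ('i \<Rightarrow> real) \<Rightarrow> bool"
  where "affine_function_of I a \<psi> \<longleftrightarrow> (\<exists>\<phi>. affine_map \<phi> \<and> (\<forall>i\<in>I. \<phi> (a i) = \<psi> i))"

lemma affine_function_of_cong:
  assumes "affine_function_of I a \<psi>" "\<And>i. i \<in> I \<Longrightarrow> \<psi> i = \<psi>' i"
  shows "affine_function_of I a \<psi>'"
  using assms unfolding affine_function_of_def by auto

lemma affine_function_of_const: "affine_function_of I a (\<lambda>i. c)"
  unfolding affine_function_of_def using affine_map_const by blast

lemma affine_function_of_add: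
  assumes "affine_function_of I a \<psi>" "affine_function_of I a \<psi>'"
  shows "affine_function_of I a (\<lambda>i. \<psi> i + \<psi>' i)"
  using assms unfolding affine_function_of_def by (metis (no_types, lifting) affine_map_add)

lemma affine_function_of_cmult:
  assumes "affine_function_of I a \<psi>"
  shows "affine_function_of I a (\<lambda>i. c * \<psi> i)"
  using assms unfolding affine_function_of_def
  by (metis (no_types, lifting) affine_map_scaleR real_scaleR_def)

lemma affine_function_of_sum:
  assumes "\<And>j. j \<in> J \<Longrightarrow> affine_function_of I a (\<psi> j)"
  shows "affine_function_of I a (\<lambda>i. \<Sum>j\<in>J. \<psi> j i)"
  using assms
  by (induction J rule: infinite_finite_induct)
    (auto intro: affine_function_of_const affine_function_of_add)

lemma lookup_scaleR_real: "Poly_Mapping.lookup (r *\<^sub>R x) k = r * Poly_Mapping.lookup x k" for r :: real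
  by (simp add: scaleR_poly_mapping_def)

lemma affine_function_of_coordinate:
  assumes "finite K" "k \<in> K"
  shows "affine_function_of I (\<lambda>i. coord_vector K (\<alpha> i)) (\<lambda>i. \<alpha> i k)"
proof -
  have "linear (\<lambda>x :: 'a \<Rightarrow>\<^sub>0 real. Poly_Mapping.lookup x k)"
    by (rule linearI) (simp_all add: lookup_add lookup_scaleR_real)
  then show ?thesis
    unfolding affine_function_of_def using linear_imp_affine_map assms
    by (force simp: lookup_coord_vector)
qed

lemma coord_vector_eq_sum:
  assumes "finite K"
  shows "coord_vector K \<alpha> = (\<Sum>k\<in>K. \<alpha> k *\<^sub>R Poly_Mapping.single k 1)"
  by (rule poly_mapping_eqI)
    (simp add: lookup_coord_vector assms lookup_sum lookup_scaleR_real lookup_single when_def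
      if_distrib[where f="\<lambda>x. _ * x"] sum.delta cong: if_cong)

text \<open>
  The affine functions chosen for the single coordinates assemble into one affine map into the
  coordinate space.
\<close>

lemma affine_map_from_coordinates:
  assumes "finite K" "\<And>k. k \<in> K \<Longrightarrow> affine_function_of I a (\<lambda>i. \<beta> i k)"
  shows "\<exists>f. affine_map f \<and> (\<forall>i\<in>I. f (a i) = coord_vector K (\<beta> i))"
proof -
  obtain \<phi> where \<phi>: "\<And>k. k \<in> K \<Longrightarrow> affine_map (\<phi> k)"
    "\<And>k i. k \<in> K \<Longrightarrow> i \<in> I \<Longrightarrow> \<phi> k (a i) = \<beta> i k"
    using assms(2) unfolding affine_function_of_def by metis
  have "affine_map (\<lambda>x. \<phi> k x *\<^sub>R Poly_Mapping.single k (1::real))" if "k \<in> K" for k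
    by (rule affine_map_compose[OF \<phi>(1)[OF that] linear_imp_affine_map])
      (rule linearI; simp add: scaleR_add_left)
  then have "affine_map (\<lambda>x. coord_vector K (\<lambda>k. \<phi> k x))"
    unfolding coord_vector_eq_sum[OF assms(1)] by (rule affine_map_sum)
  moreover have "coord_vector K (\<lambda>k. \<phi> k (a i)) = coord_vector K (\<beta> i)" if "i \<in> I" for i
    using \<phi>(2) that by (simp add: coord_vector_eq_sum assms(1))
  ultimately show ?thesis by blast
qed

lemma affinely_equivalent_coord_vectors:
  assumes "finite J" "finite K"
    and "\<And>k. k \<in> K \<Longrightarrow> affine_function_of I (\<lambda>i. coord_vector J (\<alpha> i)) (\<lambda>i. \<beta> i k)"
    and "\<And>j. j \<in> J \<Longrightarrow> affine_function_of I (\<lambda>i. coord_vector K (\<beta> i)) (\<lambda>i. \<alpha> i j)"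
  shows "affinely_equivalent I (\<lambda>i. coord_vector J (\<alpha> i)) (\<lambda>i. coord_vector K (\<beta> i))"
proof -
  obtain f where "affine_map f" "\<forall>i\<in>I. f (coord_vector J (\<alpha> i)) = coord_vector K (\<beta> i)"
    using affine_map_from_coordinates[where a = "\<lambda>i. coord_vector J (\<alpha> i)" and \<beta> = \<beta>, OF assms(2,3)]
    by blast
  moreover obtain g where "affine_map g" "\<forall>i\<in>I. g (coord_vector K (\<beta> i)) = coord_vector J (\<alpha> i)"
    using affine_map_from_coordinates[where a = "\<lambda>i. coord_vector K (\<beta> i)" and \<beta> = \<alpha>, OF assms(1,4)]
    by blast
  ultimately show ?thesis
    unfolding affinely_equivalent_def by blast
qed

section \<open>Subset indicators, parities and traces\<close>

lemma prod_of_bool_mem: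
  assumes "finite F"
  shows "(\<Prod>i\<in>F. of_bool (i \<in> S)) = (of_bool (F \<subseteq> S) :: 'a::comm_semiring_1)"
  using assms by induction auto

lemma parity_sign_eq_prod:
  assumes "finite F"
  shows "(- 1) ^ card (F \<inter> S) = (\<Prod>i\<in>F. 1 - 2 * of_bool (i \<in> S) :: 'a::comm_ring_1)"
  using assms by induction (auto simp: Int_insert_left)

text \<open>Expand the product of \<open>1 - 2[i \<in> S]\<close>.\<close>

lemma parity_sign_eq_sum_subset_indicators:
  assumes "finite F"
  shows "(- 1) ^ card (F \<inter> S) = (\<Sum>G\<in>Pow F. (- 2) ^ card G * of_bool (G \<subseteq> S) :: 'a::comm_ring_1)"
proof -
  have "(- 1) ^ card (F \<inter> S) =
      (\<Sum>G\<in>Pow F. (- 1) ^ card G * (\<Prod>i\<in>G. 2 * of_bool (i \<in> S) :: 'a))"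
    by (simp add: parity_sign_eq_prod prod_diff_conv_sum assms)
  also have "\<dots> = (\<Sum>G\<in>Pow F. (- 2) ^ card G * of_bool (G \<subseteq> S))"
  proof (rule sum.cong[OF refl])
    fix G assume "G \<in> Pow F"
    then have "finite G" using assms finite_subset by auto
    then show "(- 1) ^ card G * (\<Prod>i\<in>G. 2 * of_bool (i \<in> S)) = (- 2) ^ card G * (of_bool (G \<subseteq> S) :: 'a)"
      by (simp add: prod.distrib prod_of_bool_mem mult.assoc power_minus[of 2])
  qed
  finally show ?thesis .
qed

text \<open>
  The inverse of the previous expansion. It has the same shape because \<open>x \<mapsto> 1 - 2x\<close> is inverted
  by \<open>x \<mapsto> (1 - x) / 2\<close>.
\<close>

lemma subset_indicator_eq_sum_parity_signs:
  assumes "finite F"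
  shows "of_bool (F \<subseteq> S) =
    (1 / 2) ^ card F * (\<Sum>G\<in>Pow F. (- 1) ^ card G * (- 1) ^ card (G \<inter> S) :: real)"
proof -
  have "of_bool (F \<subseteq> S) = (\<Prod>i\<in>F. (1 / 2) * (1 - (1 - 2 * of_bool (i \<in> S))) :: real)"
    by (simp add: prod_of_bool_mem assms)
  also have "\<dots> = (1 / 2) ^ card F * (\<Prod>i\<in>F. 1 - (1 - 2 * of_bool (i \<in> S)))"
    by (simp only: prod.distrib prod_constant)
  also have "(\<Prod>i\<in>F. 1 - (1 - 2 * of_bool (i \<in> S))) =
      (\<Sum>G\<in>Pow F. (- 1) ^ card G * (\<Prod>i\<in>G. 1 - 2 * of_bool (i \<in> S)) :: real)"
    by (subst prod_diff_conv_sum[OF assms]) simp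
  also have "\<dots> = (\<Sum>G\<in>Pow F. (- 1) ^ card G * (- 1) ^ card (G \<inter> S))"
    by (intro sum.cong refl) (metis PowD assms finite_subset parity_sign_eq_prod)
  finally show ?thesis .
qed

text \<open>
  Inclusion-exclusion over the elements of \<open>F - H\<close> that \<open>S\<close> has to avoid.
\<close>

lemma trace_indicator_eq_sum_subset_indicators:
  assumes "finite F" "H \<subseteq> F"
  shows "of_bool (S \<inter> F = H) =
    (\<Sum>K\<in>Pow (F - H). (- 1) ^ card K * of_bool (H \<union> K \<subseteq> S) :: 'a::comm_ring_1)"
proof -
  have fin: "finite H" "finite (F - H)"
    using assms finite_subset by auto
  have "(\<Prod>i\<in>F - H. 1 - of_bool (i \<in> S)) = (\<Prod>i\<in>F - H. of_bool (i \<in> - S) :: 'a)"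
    by (intro prod.cong) auto
  also have "\<dots> = of_bool (F - H \<subseteq> - S)"
    using prod_of_bool_mem[OF fin(2)] .
  finally have "of_bool (S \<inter> F = H) =
      of_bool (H \<subseteq> S) * (\<Prod>i\<in>F - H. 1 - of_bool (i \<in> S) :: 'a)"
    using assms(2) by (auto simp: of_bool_def)
  also have "\<dots> = of_bool (H \<subseteq> S) *
      (\<Sum>K\<in>Pow (F - H). (- 1) ^ card K * (\<Prod>i\<in>K. of_bool (i \<in> S)))"
    by (simp add: prod_diff_conv_sum fin(2))
  also have "\<dots> = (\<Sum>K\<in>Pow (F - H). (- 1) ^ card K * of_bool (H \<union> K \<subseteq> S))"
    unfolding sum_distrib_left
  proof (rule sum.cong[OF refl])
    fix K assume "K \<in> Pow (F - H)"
    then have "finite K" using fin(2) finite_subset by auto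
    then show "of_bool (H \<subseteq> S) * ((- 1) ^ card K * (\<Prod>i\<in>K. of_bool (i \<in> S))) =
        (- 1) ^ card K * (of_bool (H \<union> K \<subseteq> S) :: 'a)"
      by (simp add: prod_of_bool_mem)
  qed
  finally show ?thesis .
qed

text \<open>
  The only term that can be nonzero is that of \<open>H = S \<inter> F\<close>, and it is present exactly when
  \<open>G \<subseteq> S\<close>.
\<close>

lemma subset_indicator_eq_sum_trace_indicators:
  assumes "finite F" "G \<subseteq> F"
  shows "of_bool (G \<subseteq> S) = (\<Sum>H | G \<subseteq> H \<and> H \<subseteq> F. of_bool (S \<inter> F = H) :: 'a::comm_semiring_1)"
proof -
  have "finite {H. G \<subseteq> H \<and> H \<subseteq> F}"
    by (rule finite_subset[of _ "Pow F"]) (use assms in auto)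
  then show ?thesis
    using assms(2) by (auto simp: of_bool_def sum.delta')
qed

section \<open>Equivalence of the three vertex families\<close>

lemma simplicial_complex_on_subset:
  "simplicial_complex_on n \<Delta> \<Longrightarrow> F \<in> \<Delta> \<Longrightarrow> G \<subseteq> F \<Longrightarrow> G \<in> \<Delta>"
  unfolding simplicial_complex_on_def by blast

lemma simplicial_complex_on_finite:
  assumes "simplicial_complex_on n \<Delta>"
  shows "finite \<Delta>" "F \<in> \<Delta> \<Longrightarrow> finite F" "finite (nonempty_faces \<Delta>)" "finite (facet_pairs \<Delta>)"
proof -
  have sub: "\<Delta> \<subseteq> Pow {1..n}"
    using assms unfolding simplicial_complex_on_def by blast
  then show fin: "finite \<Delta>"
    by (rule finite_subset) simp
  show "finite F" if "F \<in> \<Delta>"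
    using sub that by (meson PowD finite_atLeastAtMost finite_subset subsetD)
  show "finite (nonempty_faces \<Delta>)"
    using fin unfolding nonempty_faces_def by simp
  have "facet_pairs \<Delta> \<subseteq> \<Delta> \<times> \<Delta>"
    using simplicial_complex_on_subset[OF assms] unfolding facet_pairs_def facets_def by blast
  then show "finite (facet_pairs \<Delta>)"
    using fin by (meson finite_SigmaI finite_subset)
qed

lemma face_in_facet:
  assumes "simplicial_complex_on n \<Delta>" "G \<in> \<Delta>"
  obtains F where "F \<in> facets \<Delta>" "G \<subseteq> F"
  using finite_has_maximal2[OF simplicial_complex_on_finite(1)[OF assms(1)] assms(2)]
  unfolding facets_def by blast

text \<open>
  A nonempty face gives a coordinate; the empty face, which has no coordinate, gives the constant
  \<open>1\<close>. The same distinction for parity signs follows.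
\<close>

lemma affine_function_of_corr_subset_indicator:
  assumes "simplicial_complex_on n \<Delta>" "G \<in> \<Delta>"
  shows "affine_function_of I (corr_vector \<Delta>) (\<lambda>S. of_bool (G \<subseteq> S))"
proof (cases "G = {}")
  case True
  then show ?thesis
    by (simp add: affine_function_of_const)
next
  case False
  then have "G \<in> nonempty_faces \<Delta>"
    using assms(2) unfolding nonempty_faces_def by simp
  then show ?thesis
    using affine_function_of_coordinate[OF simplicial_complex_on_finite(3)[OF assms(1)], of G I
        "\<lambda>S F. if F \<subseteq> S then 1 else 0"]
    unfolding corr_vector_def of_bool_def by blast
qed

lemma affine_function_of_cut_parity_sign:
  assumes "simplicial_complex_on n \<Delta>" "G \<in> \<Delta>"
  shows "affine_function_of I (cut_vector \<Delta>) (\<lambda>S. (- 1) ^ card (G \<inter> S))"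
proof (cases "G = {}")
  case True
  then show ?thesis
    by (simp add: affine_function_of_const)
next
  case False
  then have "G \<in> nonempty_faces \<Delta>"
    using assms(2) unfolding nonempty_faces_def by simp
  then have "affine_function_of I (cut_vector \<Delta>) (\<lambda>S. if odd (card (G \<inter> S)) then 1 else 0)"
    using affine_function_of_coordinate[OF simplicial_complex_on_finite(3)[OF assms(1)], of G I
        "\<lambda>S F. if odd (card (F \<inter> S)) then 1 else 0"]
    unfolding cut_vector_def by blast
  then have "affine_function_of I (cut_vector \<Delta>)
      (\<lambda>S. 1 + (- 2) * (if odd (card (G \<inter> S)) then 1 else 0))"
    by (intro affine_function_of_add affine_function_of_const affine_function_of_cmult)
  then show ?thesis
    by (rule affine_function_of_cong) (simp add: uminus_power_if)
qed

lemma corr_cut_affinely_equivalent: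
  assumes "simplicial_complex_on n \<Delta>"
  shows "affinely_equivalent I (corr_vector \<Delta>) (cut_vector \<Delta>)"
proof -
  note fin = simplicial_complex_on_finite[OF assms]
  have "affine_function_of I (corr_vector \<Delta>) (\<lambda>S. if odd (card (F \<inter> S)) then 1 else 0)"
    if F: "F \<in> nonempty_faces \<Delta>" for F
  proof -
    have F: "F \<in> \<Delta>" using F unfolding nonempty_faces_def by simp
    have "affine_function_of I (corr_vector \<Delta>)
        (\<lambda>S. 1 / 2 + (- (1 / 2)) * (\<Sum>G\<in>Pow F. (- 2) ^ card G * of_bool (G \<subseteq> S)))"
      by (intro affine_function_of_add affine_function_of_const affine_function_of_cmult
          affine_function_of_sum affine_function_of_corr_subset_indicator[OF assms])
        (use simplicial_complex_on_subset[OF assms F] in blast)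
    then show ?thesis
      by (rule affine_function_of_cong)
        (simp only: parity_sign_eq_sum_subset_indicators[OF fin(2)[OF F], symmetric], simp)
  qed
  moreover have "affine_function_of I (cut_vector \<Delta>) (\<lambda>S. if F \<subseteq> S then 1 else 0)"
    if F: "F \<in> nonempty_faces \<Delta>" for F
  proof -
    have F: "F \<in> \<Delta>" using F unfolding nonempty_faces_def by simp
    have "affine_function_of I (cut_vector \<Delta>)
        (\<lambda>S. (1 / 2) ^ card F * (\<Sum>G\<in>Pow F. (- 1) ^ card G * (- 1) ^ card (G \<inter> S)))"
      by (intro affine_function_of_cmult affine_function_of_sum
          affine_function_of_cut_parity_sign[OF assms])
        (use simplicial_complex_on_subset[OF assms F] in blast)
    then show ?thesis
      by (rule affine_function_of_cong)
        (simp add: of_bool_def flip: subset_indicator_eq_sum_parity_signs[OF fin(2)[OF F]])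
  qed
  ultimately show ?thesis
    unfolding corr_vector_def cut_vector_def
    by (intro affinely_equivalent_coord_vectors fin(3))
qed

lemma corr_marg_affinely_equivalent:
  assumes "simplicial_complex_on n \<Delta>"
  shows "affinely_equivalent I (corr_vector \<Delta>) (marg_vector \<Delta>)"
proof -
  note fin = simplicial_complex_on_finite[OF assms]
  have "affine_function_of I (corr_vector \<Delta>) (\<lambda>S. case p of (H, F) \<Rightarrow> if S \<inter> F = H then 1 else 0)"
    if "p \<in> facet_pairs \<Delta>" for p
  proof -
    obtain H F where "p = (H, F)"
      by (cases p)
    then have p: "p = (H, F)" "H \<subseteq> F" "F \<in> \<Delta>"
      using that unfolding facet_pairs_def facets_def by blast+
    have "affine_function_of I (corr_vector \<Delta>)
        (\<lambda>S. \<Sum>K\<in>Pow (F - H). (- 1) ^ card K * of_bool (H \<union> K \<subseteq> S))"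
      by (intro affine_function_of_cmult affine_function_of_sum
          affine_function_of_corr_subset_indicator[OF assms]
          simplicial_complex_on_subset[OF assms p(3)]) (use p(2) in blast)
    then show ?thesis
      by (rule affine_function_of_cong)
        (simp only: trace_indicator_eq_sum_subset_indicators[OF fin(2)[OF p(3)] p(2), symmetric],
          simp add: p(1))
  qed
  moreover have "affine_function_of I (marg_vector \<Delta>) (\<lambda>S. if G \<subseteq> S then 1 else 0)"
    if "G \<in> nonempty_faces \<Delta>" for G
  proof -
    obtain F where F: "F \<in> facets \<Delta>" "G \<subseteq> F"
      using face_in_facet[OF assms] \<open>G \<in> nonempty_faces \<Delta>\<close> unfolding nonempty_faces_def by blast
    then have "finite F"
      using fin(2) unfolding facets_def by blast
    have "affine_function_of I (marg_vector \<Delta>) (\<lambda>S. of_bool (S \<inter> F = H))" if "H \<subseteq> F" for H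
    proof -
      have "(H, F) \<in> facet_pairs \<Delta>"
        using F that unfolding facet_pairs_def by simp
      from affine_function_of_coordinate[OF fin(4) this, of I
          "\<lambda>S (H, F). if S \<inter> F = H then 1 else 0"]
      show ?thesis
        unfolding marg_vector_def of_bool_def by simp
    qed
    then have "affine_function_of I (marg_vector \<Delta>)
        (\<lambda>S. \<Sum>H | G \<subseteq> H \<and> H \<subseteq> F. of_bool (S \<inter> F = H))"
      by (intro affine_function_of_sum) blast
    then show ?thesis
      by (rule affine_function_of_cong)
        (simp only: subset_indicator_eq_sum_trace_indicators[OF \<open>finite F\<close> F(2), symmetric],
          simp)
  qed
  ultimately show ?thesis
    unfolding corr_vector_def marg_vector_def
    by (intro affinely_equivalent_coord_vectors fin)
qed

section \<open>The dimension of the correlation polytope\<close>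

lemma independent_single_image:
  assumes "finite K"
  shows "independent ((\<lambda>k. Poly_Mapping.single k (1::real)) ` K)"
    and "card ((\<lambda>k. Poly_Mapping.single k (1::real)) ` K) = card K"
proof -
  have inj: "inj_on (\<lambda>k. Poly_Mapping.single k (1::real)) K"
    by (rule inj_onI) (metis lookup_single_eq lookup_single_not_eq zero_neq_one)
  then show "card ((\<lambda>k. Poly_Mapping.single k (1::real)) ` K) = card K"
    by (rule card_image)
  show "independent ((\<lambda>k. Poly_Mapping.single k (1::real)) ` K)"
  proof (rule independent_if_scalars_zero)
    fix c x
    assume "(\<Sum>v\<in>(\<lambda>k. Poly_Mapping.single k (1::real)) ` K. c v *\<^sub>R v) = 0"
      and "x \<in> (\<lambda>k. Poly_Mapping.single k (1::real)) ` K"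
    then obtain k where k: "k \<in> K" "x = Poly_Mapping.single k 1"
      and "coord_vector K (\<lambda>k. c (Poly_Mapping.single k 1)) = 0"
      by (auto simp: sum.reindex[OF inj] coord_vector_eq_sum[OF assms])
    then have "Poly_Mapping.lookup (coord_vector K (\<lambda>k. c (Poly_Mapping.single k 1))) k = 0"
      by simp
    then show "c x = 0"
      using k by (simp add: lookup_coord_vector assms)
  qed (use assms in simp)
qed

text \<open>
  The vertex of \<open>S = {}\<close> is the origin, so the affine hull of the vertices is their linear span,
  which turns out to be spanned by the unit vectors of the nonempty faces.
\<close>

lemma affine_dimension_Corr:
  assumes "simplicial_complex_on n \<Delta>"
  shows "affine_dimension (Corr n \<Delta>) = card (nonempty_faces \<Delta>)"
proof -
  define N where "N = nonempty_faces \<Delta>"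
  define V where "V = {corr_vector \<Delta> S | S. S \<subseteq> {1..n}}"
  define E where "E = (\<lambda>F :: nat set. Poly_Mapping.single F (1::real)) ` N"
  have finN: "finite N"
    using simplicial_complex_on_finite(3)[OF assms] by (simp add: N_def)
  have corr: "corr_vector \<Delta> S = (\<Sum>F | F \<in> N \<and> F \<subseteq> S. Poly_Mapping.single F 1)" for S
  proof -
    have "corr_vector \<Delta> S = (\<Sum>F\<in>N. if F \<subseteq> S then Poly_Mapping.single F 1 else 0)"
      unfolding corr_vector_def N_def[symmetric] coord_vector_eq_sum[OF finN]
      by (intro sum.cong) auto
    then show ?thesis
      by (simp add: sum.inter_filter[OF finN])
  qed
  have "corr_vector \<Delta> {} \<in> V"
    unfolding V_def by blast
  moreover have "{F \<in> N. F \<subseteq> {}} = {}"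
    unfolding N_def nonempty_faces_def by blast
  then have "corr_vector \<Delta> {} = 0"
    unfolding corr by (metis sum.empty)
  ultimately have "affine hull V = span V"
    by (metis affine_hull_span_0 hull_inc)
  moreover have "V \<subseteq> span E"
  proof
    fix v assume "v \<in> V"
    then obtain S where v: "v = corr_vector \<Delta> S"
      unfolding V_def by blast
    show "v \<in> span E"
      unfolding v corr by (rule span_sum, rule span_base) (simp add: E_def)
  qed
  \<comment> \<open>The vertex of a face \<open>F\<close> is the unit vector of \<open>F\<close> plus those of the proper nonempty
    subfaces of \<open>F\<close>, so induction on \<open>F\<close> recovers the unit vectors from the vertices.\<close>
  moreover have "Poly_Mapping.single F 1 \<in> span V" if "F \<in> N" for F
  proof -
    have "finite F"
      using that simplicial_complex_on_finite(2)[OF assms] by (auto simp: N_def nonempty_faces_def)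
    then show ?thesis
      using that
    proof (induction F rule: finite_psubset_induct)
      case (psubset F)
      have "F \<subseteq> {1..n}"
        using psubset.prems assms
        unfolding N_def nonempty_faces_def simplicial_complex_on_def by blast
      then have F: "corr_vector \<Delta> F \<in> span V"
        unfolding V_def by (auto intro: span_base)
      have "{G \<in> N. G \<subseteq> F} = insert F {G \<in> N. G \<subset> F}"
        using psubset.prems by blast
      then have split: "corr_vector \<Delta> F =
          Poly_Mapping.single F 1 + (\<Sum>G | G \<in> N \<and> G \<subset> F. Poly_Mapping.single G 1)"
        using finN by (simp add: corr)
      have "(\<Sum>G | G \<in> N \<and> G \<subset> F. Poly_Mapping.single G (1::real)) \<in> span V"
        by (rule span_sum) (use psubset.IH in blast)
      from span_diff[OF F this] show ?case
        by (simp add: split)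
    qed
  qed
  then have "E \<subseteq> span V"
    unfolding E_def by blast
  ultimately have hull: "affine hull V = span E"
    by (simp add: span_eq)
  have "{x - y | x y. x \<in> span E \<and> y \<in> span E} = span E"
  proof
    show "span E \<subseteq> {x - y | x y. x \<in> span E \<and> y \<in> span E}"
      using span_zero by force
  qed (auto intro: span_diff)
  then show ?thesis
    unfolding affine_dimension_def Corr_def affine_hull_convex_hull V_def[symmetric] hull
    using dim_eq_card_independent[OF independent_single_image(1)[OF finN]]
      independent_single_image(2)[OF finN]
    by (simp add: E_def N_def)
qed

theorem theorem3p5:
  fixes n :: nat and \<Delta> :: "nat set set"
  assumes "simplicial_complex_on n \<Delta>"
  shows "affinely_isomorphic (GCut n \<Delta>) (Corr n \<Delta>)
    \<and> affinely_isomorphic (Corr n \<Delta>) (Marg n \<Delta>)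
    \<and> affinely_isomorphic (GCut n \<Delta>) (Marg n \<Delta>)
    \<and> affine_dimension (GCut n \<Delta>) = card (nonempty_faces \<Delta>)
    \<and> affine_dimension (Corr n \<Delta>) = card (nonempty_faces \<Delta>)
    \<and> affine_dimension (Marg n \<Delta>) = card (nonempty_faces \<Delta>)"
proof -
  let ?I = "{S. S \<subseteq> {1..n}}"
  have hulls: "GCut n \<Delta> = convex hull (cut_vector \<Delta> ` ?I)"
    "Corr n \<Delta> = convex hull (corr_vector \<Delta> ` ?I)"
    "Marg n \<Delta> = convex hull (marg_vector \<Delta> ` ?I)"
    unfolding GCut_def Corr_def Marg_def by (simp_all only: image_Collect)
  have cut: "affinely_equivalent ?I (cut_vector \<Delta>) (corr_vector \<Delta>)"
    by (rule affinely_equivalent_sym[OF corr_cut_affinely_equivalent[OF assms]])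
  have marg: "affinely_equivalent ?I (corr_vector \<Delta>) (marg_vector \<Delta>)"
    by (rule corr_marg_affinely_equivalent[OF assms])
  show ?thesis
    unfolding hulls
    using affinely_equivalent_imp_affinely_isomorphic[OF cut]
      affinely_equivalent_imp_affinely_isomorphic[OF marg]
      affinely_equivalent_imp_affinely_isomorphic[OF affinely_equivalent_trans[OF cut marg]]
      affinely_equivalent_imp_affine_dimension_eq[OF cut]
      affinely_equivalent_imp_affine_dimension_eq[OF marg]
      affine_dimension_Corr[OF assms, unfolded hulls]
    by simp
qed

end
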